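(* For every real $u$ with $-1\le u\le 1$, $$-\frac12\int_0^1\frac{\log^2(1-x)\,\log\left[1-u(1-x)\right]}{1-x}\,dx=Li_4(u).$$
   Context: $Li_4(u)=\sum_{n=1}^\infty \frac{u^n}{n^4}$ is the polylogarithm of order $4$; $\log^2 y=(\log y)^2$. *)

theory Defs
  imports "HOL-Analysis.Analysis"
begin

definition Li :: "nat \<Rightarrow> real \<Rightarrow> real" where
  "Li s u = (\<Sum>n. u ^ Suc n / real (Suc n) ^ s)"

lemma summable_Li:
  assumes "s \<ge> 2" "-1 \<le> u" "u \<le> 1"
  shows "summable (\<lambda>n. u ^ Suc n / real (Suc n) ^ s)"
proof (rule summable_comparison_test')
  show "summable (\<lambda>n. 1 / real (Suc n) ^ s)"
    using inverse_power_summable[OF assms(1), where 'a = real]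
    by (subst (asm) summable_Suc_iff [symmetric]) (simp add: field_simps)
  show "norm (u ^ Suc n / real (Suc n) ^ s) \<le> 1 / real (Suc n) ^ s" for n
  proof -
    have "\<bar>u\<bar> ^ Suc n \<le> 1"
      using assms by (intro power_le_one) auto
    then show ?thesis
      by (simp add: abs_mult power_abs divide_right_mono del: of_nat_Suc power_Suc)
  qed
qed

end

theory Submission
  imports Defs "HOL-Real_Asymp.Real_Asymp"
begin

text \<open>
  With \<open>t = 1 - x\<close>, expand \<open>- ln (1 - u t) / t = (\<Sum>n. u ^ Suc n * t ^ n / Suc n)\<close> and integrate
  termwise against \<open>ln\<^sup>2 t\<close>, using that the moment \<open>\<integral> t ^ n * ln\<^sup>2 t\<close> over \<open>(0, 1)\<close> is
  \<open>2 / (Suc n) ^ 3\<close>. The interchange is justified because the integrals of the absolute values of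
  the terms are at most \<open>2 / (Suc n) ^ 4\<close>, even for \<open>\<bar>u\<bar> = 1\<close>.
\<close>

lemma ln_one_minus_sums:
  fixes y :: real
  assumes "\<bar>y\<bar> < 1"
  shows "(\<lambda>n. - (y ^ Suc n / real (Suc n))) sums ln (1 - y)"
proof -
  have "(\<lambda>n. - (y ^ n) / real n) sums ln (1 - y)"
    using Complex_Transcendental.ln_series'[of "- y"] assms by simp
  then show ?thesis
    \<comment> \<open>The index shift loses nothing: the term at \<open>n = 0\<close> is a division
      by zero, hence \<open>0\<close>.\<close>
    using sums_Suc_iff[of "\<lambda>n. - (y ^ n) / real n" "ln (1 - y)"]
    by (simp del: of_nat_Suc power_Suc)
qed

lemma ln_squared_moment:
  fixes n :: nat
  defines "f \<equiv> \<lambda>x::real. (1 - x) ^ n * (ln (1 - x))\<^sup>2"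
  shows "set_integrable lborel {0<..<1} f"
    and "(LBINT x:{0<..<1}. f x) = 2 / real (Suc n) ^ 3"
proof -
  define c where "c = real (Suc n)"
  have c: "c > 0" by (simp add: c_def)
  \<comment> \<open>Integrating \<open>t ^ n * (ln t)\<^sup>2\<close> by parts twice gives this
    antiderivative; the outer minus sign comes from \<open>t = 1 - x\<close>. One factor
    \<open>1 - x\<close> is kept next to each logarithm so that every summand tends to 0 at 1, even
    for \<open>n = 0\<close>; \<open>F_eq\<close> regroups it for differentiation.\<close>
  define F where "F = (\<lambda>x::real. - ((1 - x) ^ n * ((1 - x) * (ln (1 - x))\<^sup>2 / c
      - 2 * ((1 - x) * ln (1 - x)) / c\<^sup>2 + 2 * (1 - x) / c ^ 3)))"
  have F_eq: "F = (\<lambda>x. - ((1 - x) ^ Suc n * ((ln (1 - x))\<^sup>2 / c - 2 * ln (1 - x) / c\<^sup>2 + 2 / c ^ 3)))"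
    by (simp add: F_def fun_eq_iff algebra_simps diff_divide_distrib add_divide_distrib)
  have deriv: "DERIV F x :> f x" if "x < 1" for x
  proof -
    have "DERIV F x :> - (- (c * (1 - x) ^ n) * ((ln (1 - x))\<^sup>2 / c - 2 * ln (1 - x) / c\<^sup>2 + 2 / c ^ 3)
        + (1 - x) ^ Suc n * (- 2 * ln (1 - x) / (1 - x) / c + 2 / (1 - x) / c\<^sup>2))"
      unfolding F_eq using that c
      by (auto intro!: derivative_eq_intros simp: c_def power2_eq_square power4_eq_xxxx
          simp del: power_Suc of_nat_Suc)
    also have "- (- (c * (1 - x) ^ n) * ((ln (1 - x))\<^sup>2 / c - 2 * ln (1 - x) / c\<^sup>2 + 2 / c ^ 3)
        + (1 - x) ^ Suc n * (- 2 * ln (1 - x) / (1 - x) / c + 2 / (1 - x) / c\<^sup>2)) = f x"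
    proof -
      \<comment> \<open>With the power and the logarithm replaced by free variables \<open>p\<close>
        and \<open>L\<close>, only a rational identity remains.\<close>
      have "- (- (c * p) * (L\<^sup>2 / c - 2 * L / c\<^sup>2 + 2 / c ^ 3)
          + t * p * (- 2 * L / t / c + 2 / t / c\<^sup>2)) = p * L\<^sup>2" if "t > 0" for t p L :: real
        using that c by (simp add: field_simps power2_eq_square power3_eq_cube)
      from this[of "1 - x" "(1 - x) ^ n" "ln (1 - x)"] show ?thesis
        using that by (simp add: f_def)
    qed
    finally show ?thesis .
  qed
  have cont: "isCont f x" if "x < 1" for x
    unfolding f_def using that by (auto intro!: continuous_intros)
  have "isCont F 0"
    using deriv[of 0] by (auto intro: DERIV_isCont)
  then have "(F \<longlongrightarrow> F 0) (at_right 0)"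
    by (auto simp: isCont_def intro: filterlim_mono at_le)
  moreover have "F 0 = - 2 / c ^ 3"
    by (simp add: F_def)
  ultimately have lim0: "(F \<longlongrightarrow> - 2 / c ^ 3) (at_right 0)" by simp
  have l1: "((\<lambda>x::real. (1 - x) * (ln (1 - x))\<^sup>2) \<longlongrightarrow> 0) (at_left 1)" by real_asymp
  have l2: "((\<lambda>x::real. (1 - x) * ln (1 - x)) \<longlongrightarrow> 0) (at_left 1)" by real_asymp
  have "(F \<longlongrightarrow> - ((1 - 1) ^ n * (0 / c - 2 * 0 / c\<^sup>2 + 2 * (1 - 1) / c ^ 3))) (at_left 1)"
    unfolding F_def using c by (intro tendsto_intros l1 l2) auto
  then have lim1: "(F \<longlongrightarrow> 0) (at_left 1)" by simp
  \<comment> \<open>Since \<open>f\<close> is nonnegative, the fundamental theorem yields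
    integrability together with the value, from the one-sided limits of \<open>F\<close>
    alone.\<close>
  have "set_integrable lborel (einterval (ereal 0) (ereal 1)) f"
    and "(LBINT x=ereal 0..ereal 1. f x) = 0 - (- 2 / c ^ 3)"
    using lim0 lim1 deriv cont
    by (intro interval_integral_FTC_nonneg[where F = F];
        simp add: ereal_tendsto_simps1 f_def del: zero_ereal_def)+
  then show "set_integrable lborel {0<..<1} f"
    and "(LBINT x:{0<..<1}. f x) = 2 / real (Suc n) ^ 3"
    by (simp_all add: c_def interval_lebesgue_integral_def del: of_nat_Suc)
qed

theorem mainTheorem6:
  fixes u :: real
  assumes "-1 \<le> u" and "u \<le> 1"
  shows "interval_lebesgue_integrable lborel 0 1
           (\<lambda>x. (ln (1 - x))\<^sup>2 * ln (1 - u * (1 - x)) / (1 - x))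
       \<and> - (1 / 2) * (LBINT x=0..1. (ln (1 - x))\<^sup>2 * ln (1 - u * (1 - x)) / (1 - x)) = Li 4 u"
proof -
  define g where "g = (\<lambda>x. (ln (1 - x))\<^sup>2 * ln (1 - u * (1 - x)) / (1 - x))"
  \<comment> \<open>The indicator turns everything into integrals over the whole line, as the
    theorems on termwise integration expect.\<close>
  define m where "m = (\<lambda>(n::nat) x. indicator {0<..<1::real} x * ((1 - x) ^ n * (ln (1 - x))\<^sup>2))"
  define a where "a = (\<lambda>n. - (u ^ Suc n / real (Suc n)))"
  have m_int: "integrable lborel (m n)" and m_val: "integral\<^sup>L lborel (m n) = 2 / real (Suc n) ^ 3" for n
    using ln_squared_moment[of n]
    by (simp_all add: set_integrable_def set_lebesgue_integral_def m_def del: of_nat_Suc)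
  have m_nonneg: "m n x \<ge> 0" for n x
    by (simp add: m_def indicator_def)
  have sums: "(\<lambda>n. a n * m n x) sums (indicator {0<..<1} x * g x)" for x
  proof (cases "x \<in> {0<..<1}")
    case True
    \<comment> \<open>For \<open>x\<close> in the open interval, strictness comes from
      \<open>1 - x < 1\<close>, so the logarithm series also applies when
      \<open>\<bar>u\<bar> = 1\<close>.\<close>
    have "\<bar>u * (1 - x)\<bar> \<le> 1 * \<bar>1 - x\<bar>"
      unfolding abs_mult using assms by (intro mult_right_mono) auto
    also have "\<dots> < 1" using True by auto
    finally have "\<bar>u * (1 - x)\<bar> < 1" .
    from sums_mult[OF ln_one_minus_sums[OF this], of "(ln (1 - x))\<^sup>2 / (1 - x)"]
    have "(\<lambda>n. (ln (1 - x))\<^sup>2 / (1 - x) * - ((u * (1 - x)) ^ Suc n / real (Suc n))) sums g x"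
      by (simp add: g_def del: of_nat_Suc power_Suc)
    moreover have "(ln (1 - x))\<^sup>2 / (1 - x) * - ((u * (1 - x)) ^ Suc n / real (Suc n)) = a n * m n x" for n
      using True by (simp add: a_def m_def power_mult_distrib del: of_nat_Suc)
    ultimately show ?thesis using True by simp
  qed (simp add: m_def)
  have abs_integral: "(\<integral>x. norm (a n * m n x) \<partial>lborel) = 2 * (\<bar>u\<bar> ^ Suc n / real (Suc n) ^ 4)" for n
  proof -
    have "(\<integral>x. norm (a n * m n x) \<partial>lborel) = \<bar>a n\<bar> * integral\<^sup>L lborel (m n)"
      using m_nonneg by (simp add: abs_mult)
    then show ?thesis
      by (simp add: m_val a_def abs_mult power_abs power4_eq_xxxx power3_eq_cube mult_ac del: of_nat_Suc)
  qed
  \<comment> \<open>By \<open>abs_integral\<close> this is twice the series of \<open>Li 4\<close>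
    at \<open>\<bar>u\<bar>\<close>, which lies in [0, 1].\<close>
  have summable_integrals: "summable (\<lambda>n. \<integral>x. norm (a n * m n x) \<partial>lborel)"
    unfolding abs_integral using assms by (intro summable_mult summable_Li) auto
  have summable_norm: "AE x in lborel. summable (\<lambda>n. norm (a n * m n x))"
  proof (intro AE_I2)
    fix x :: real
    show "summable (\<lambda>n. norm (a n * m n x))"
    proof (cases "x \<in> {0<..<1}")
      case True
      \<comment> \<open>As \<open>\<bar>a n\<bar> \<le> 1\<close>, a geometric series of ratio
        \<open>1 - x\<close> dominates at each fixed \<open>x\<close>.\<close>
      have "summable (\<lambda>n. (1 - x) ^ n * (ln (1 - x))\<^sup>2)"
        using True by (intro summable_mult2 summable_geometric) auto
      moreover have "norm (norm (a n * m n x)) \<le> (1 - x) ^ n * (ln (1 - x))\<^sup>2" for n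
      proof -
        have "\<bar>u\<bar> ^ Suc n \<le> 1" using assms by (intro power_le_one) auto
        then have "\<bar>a n\<bar> \<le> 1"
          by (simp add: a_def power_abs divide_le_eq del: power_Suc)
        then have "\<bar>a n\<bar> * m n x \<le> 1 * m n x"
          using m_nonneg by (intro mult_right_mono)
        then show ?thesis using True m_nonneg[of n x] by (simp add: abs_mult m_def)
      qed
      ultimately show ?thesis by (rule summable_comparison_test')
    qed (simp add: m_def)
  qed
  have am_int: "integrable lborel (\<lambda>x. a n * m n x)" for n
    using m_int by simp
  have suminf_eq: "(\<lambda>x. \<Sum>n. a n * m n x) = (\<lambda>x. indicator {0<..<1} x * g x)"
    using sums by (simp add: sums_iff)
  have g_int: "integrable lborel (\<lambda>x. indicator {0<..<1} x * g x)"
    using integrable_suminf[OF am_int summable_norm summable_integrals] by (simp add: suminf_eq)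
  have "(\<lambda>n. \<integral>x. a n * m n x \<partial>lborel) sums (\<integral>x. indicator {0<..<1} x * g x \<partial>lborel)"
    using sums_integral[OF am_int summable_norm summable_integrals] by (simp add: suminf_eq)
  then have "(\<lambda>n. - 1 / 2 * (a n * (2 / real (Suc n) ^ 3))) sums
      (- 1 / 2 * (\<integral>x. indicator {0<..<1} x * g x \<partial>lborel))"
    by (intro sums_mult) (simp add: m_val del: of_nat_Suc)
  \<comment> \<open>The coefficient supplies one factor \<open>1 / Suc n\<close> and the moment
    three, giving order 4; the factor \<open>- 1 / 2\<close> cancels the 2 of the moment and the
    sign of \<open>a n\<close>.\<close>
  moreover have "- 1 / 2 * (a n * (2 / real (Suc n) ^ 3)) = u ^ Suc n / real (Suc n) ^ 4" for n
    by (simp add: a_def power4_eq_xxxx power3_eq_cube del: of_nat_Suc)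
  ultimately have "Li 4 u = - 1 / 2 * (\<integral>x. indicator {0<..<1} x * g x \<partial>lborel)"
    by (simp add: Li_def sums_iff del: of_nat_Suc power_Suc)
  with g_int show ?thesis
    unfolding g_def [symmetric]
    by (simp add: interval_lebesgue_integrable_def interval_lebesgue_integral_def
        set_integrable_def set_lebesgue_integral_def zero_ereal_def one_ereal_def)
qed

end
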